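(* Let $\alpha>0$, let $\mu$ be a probability measure on a measurable space $\mathcal{X}$, and let $h:\mathcal{X}\to(0,\infty)^d$ and the open convex set $\Omega\subset\mathbb{R}^d$ be as in the context. Consider the potential function $$\varphi(\xi)=\log\int_{\mathcal{X}}(1+\alpha\,\xi\cdot h(x))^{1/\alpha}\,d\mu(x),\qquad\xi\in\Omega,$$ of the $\mathcal{F}^{(-\alpha)}$-family $p(x,\xi)=(1+\alpha\xi\cdot h(x))^{1/\alpha}e^{-\varphi(\xi)}$. 1. If $0<\alpha<1$, then $\varphi$ is $\alpha$-exponentially convex, i.e. $e^{\alpha\varphi}$ is convex on $\Omega$. 2. If $\alpha>1$, then $\varphi$ is $\alpha$-exponentially concave, i.e. $e^{\alpha\varphi}$ is concave on $\Omega$.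
   Context: Standing assumptions: $h=(h^1,\dots,h^d)$ is measurable with positive components and such that $\xi\cdot h=\xi'\cdot h$ $\mu$-a.e. implies $\xi=\xi'$; for all $\xi\in\Omega$, $1+\alpha\xi\cdot h>0$ on $\mathcal{X}$, the integral defining $\varphi(\xi)$ is finite, and one can differentiate it with respect to $\xi$ under the integral sign (as many times as needed). *)

theory Defs
  imports "HOL-Probability.Probability"
begin

text \<open>
  The unnormalised member \<open>(1 + \<alpha> \<xi> \<cdot> h x) powr (1/\<alpha>)\<close> of the deformed exponential family.
  Since \<open>powr\<close> is totalised at nonpositive bases, it is only meaningful where
  \<open>1 + \<alpha> \<xi> \<cdot> h x > 0\<close>.
\<close>

definition unnormalised :: "real \<Rightarrow> ('x \<Rightarrow> real ^ 'd) \<Rightarrow> real ^ 'd \<Rightarrow> 'x \<Rightarrow> real" where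
  "unnormalised \<alpha> h \<xi> x = (1 + \<alpha> * (\<xi> \<bullet> h x)) powr (1 / \<alpha>)"

definition potential :: "real \<Rightarrow> 'x measure \<Rightarrow> ('x \<Rightarrow> real ^ 'd) \<Rightarrow> real ^ 'd \<Rightarrow> real" where
  "potential \<alpha> M h \<xi> = ln (\<integral>x. unnormalised \<alpha> h \<xi> x \<partial>M)"

definition family_density ::
  "real \<Rightarrow> 'x measure \<Rightarrow> ('x \<Rightarrow> real ^ 'd) \<Rightarrow> real ^ 'd \<Rightarrow> 'x \<Rightarrow> real" where
  "family_density \<alpha> M h \<xi> x = unnormalised \<alpha> h \<xi> x * exp (- potential \<alpha> M h \<xi>)"

lemma integral_family_density:
  assumes "prob_space M"
    and "\<And>x. x \<in> space M \<Longrightarrow> 1 + \<alpha> * (\<xi> \<bullet> h x) > 0"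
    and "integrable M (unnormalised \<alpha> h \<xi>)"
  shows "(\<integral>x. family_density \<alpha> M h \<xi> x \<partial>M) = 1"
proof -
  interpret prob_space M by fact
  have pos: "unnormalised \<alpha> h \<xi> x > 0" if "x \<in> space M" for x
    using assms(2)[OF that] by (simp add: unnormalised_def)
  have "(\<integral>x. unnormalised \<alpha> h \<xi> x \<partial>M) > 0"
    using expectation_greater[OF assms(3), of 0] pos by simp
  then show ?thesis
    by (simp add: family_density_def potential_def exp_minus)
qed

definition exponentially_convex_on :: "real \<Rightarrow> 'a::real_vector set \<Rightarrow> ('a \<Rightarrow> real) \<Rightarrow> bool" where
  "exponentially_convex_on \<alpha> S \<phi> \<longleftrightarrow> convex_on S (\<lambda>\<xi>. exp (\<alpha> * \<phi> \<xi>))"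

definition exponentially_concave_on :: "real \<Rightarrow> 'a::real_vector set \<Rightarrow> ('a \<Rightarrow> real) \<Rightarrow> bool" where
  "exponentially_concave_on \<alpha> S \<phi> \<longleftrightarrow> concave_on S (\<lambda>\<xi>. exp (\<alpha> * \<phi> \<xi>))"

definition partial_deriv :: "'d \<Rightarrow> (real ^ 'd \<Rightarrow> real) \<Rightarrow> real ^ 'd \<Rightarrow> real" where
  "partial_deriv i g \<xi> = deriv (\<lambda>t. g (\<xi> + t *\<^sub>R axis i 1)) 0"

primrec partial_derivs :: "'d list \<Rightarrow> (real ^ 'd \<Rightarrow> real) \<Rightarrow> real ^ 'd \<Rightarrow> real" where
  "partial_derivs [] g = g"
| "partial_derivs (i # is) g = partial_deriv i (partial_derivs is g)"

text \<open>
  Differentiation of \<open>\<xi> \<mapsto> \<integral> F \<xi> x dM\<close> under the integral sign, up to order \<open>n\<close>: on \<open>S\<close>, each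
  iterated partial derivative of \<open>F\<close> of order at most \<open>n\<close> exists and is integrable in \<open>x\<close>, and
  the partial derivative of the integral of a derivative of order less than \<open>n\<close> exists and is
  the integral of the next derivative.
  Since \<open>deriv\<close> is total, existence of the derivatives has to be required separately.
\<close>

definition differentiable_under_integral ::
  "nat \<Rightarrow> 'x measure \<Rightarrow> (real ^ 'd) set \<Rightarrow> (real ^ 'd \<Rightarrow> 'x \<Rightarrow> real) \<Rightarrow> bool" where
  "differentiable_under_integral n M S F \<longleftrightarrow>
    (\<forall>\<xi>\<in>S. integrable M (F \<xi>)) \<and>
    (\<forall>is i. length is < n \<longrightarrow> (\<forall>\<xi>\<in>S.
      (\<forall>x\<in>space M. (\<lambda>t. partial_derivs is (\<lambda>\<eta>. F \<eta> x) (\<xi> + t *\<^sub>R axis i 1))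
         differentiable (at 0)) \<and>
      integrable M (\<lambda>x. partial_derivs (i # is) (\<lambda>\<eta>. F \<eta> x) \<xi>) \<and>
      ((\<lambda>t. \<integral>x. partial_derivs is (\<lambda>\<eta>. F \<eta> x) (\<xi> + t *\<^sub>R axis i 1) \<partial>M)
         has_real_derivative (\<integral>x. partial_derivs (i # is) (\<lambda>\<eta>. F \<eta> x) \<xi> \<partial>M)) (at 0)))"

end

theory Submission
  imports Defs
begin

text \<open>
  With \<open>p = 1/\<alpha>\<close>, \<open>exp (\<alpha> \<phi> \<xi>)\<close> is the functional \<open>(\<integral> u powr p) powr (1/p)\<close> at the positive
  function \<open>u = 1 + \<alpha> \<xi> \<cdot> h\<close>, which is affine in \<open>\<xi>\<close>. So the claims are Minkowski's inequality
  for \<open>p > 1\<close> and its reverse for \<open>0 < p < 1\<close>. Both follow by writing \<open>c u + d v\<close>, divided by the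
  combination \<open>c a + d b\<close> of the values \<open>a\<close>, \<open>b\<close> of the functional at \<open>u\<close>, \<open>v\<close>, as a convex
  combination of the normalised functions \<open>u/a\<close> and \<open>v/b\<close>.
\<close>

text \<open>The second derivative has the sign of \<open>p * (p - 1)\<close>. This supplies the
  reverse inequality, where \<open>p = 1 / \<alpha>\<close> with \<alpha> > 1.\<close>

lemma powr_concave:
  assumes "0 \<le> p" "p \<le> 1"
  shows "concave_on {0<..} (\<lambda>x::real. x powr p)"
proof (rule f''_le0_imp_concave)
  fix x :: real assume "x \<in> {0<..}"
  then have x: "x > 0" by simp
  show "((\<lambda>x. x powr p) has_real_derivative p * x powr (p - 1)) (at x)"
    using x by (auto intro!: derivative_eq_intros)
  show "((\<lambda>x. p * x powr (p - 1)) has_real_derivative p * (p - 1) * x powr (p - 2)) (at x)"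
    using x by (auto intro!: derivative_eq_intros)
  show "p * (p - 1) * x powr (p - 2) \<le> 0"
    using assms by (simp add: mult_nonneg_nonpos mult_nonpos_nonneg)
qed simp

text \<open>The sign \<open>\<sigma>\<close> treats the direct (\<open>\<sigma> = 1\<close>) and the reverse (\<open>\<sigma> = -1\<close>) inequality at once.\<close>

lemma signed_Minkowski_integral:
  fixes u v :: "'x \<Rightarrow> real"
  assumes conv: "convex_on {0<..} (\<lambda>x::real. \<sigma> * x powr p)"
    and u: "\<And>x. x \<in> space M \<Longrightarrow> u x > 0" "integrable M (\<lambda>x. u x powr p)"
    and v: "\<And>x. x \<in> space M \<Longrightarrow> v x > 0" "integrable M (\<lambda>x. v x powr p)"
    and uv: "integrable M (\<lambda>x. (c * u x + d * v x) powr p)"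
    and cd: "c \<ge> 0" "d \<ge> 0" "c + d = 1"
    and a: "a > 0" "a powr p = (\<integral>x. u x powr p \<partial>M)"
    and b: "b > 0" "b powr p = (\<integral>x. v x powr p \<partial>M)"
  shows "\<sigma> * (\<integral>x. (c * u x + d * v x) powr p \<partial>M) \<le> \<sigma> * (c * a + d * b) powr p"
proof -
  define s where "s = c * a + d * b"
  \<comment> \<open>Chosen so that \<open>\<kappa> / a = c / s\<close> and
    \<open>\<rho> / b = d / s\<close>: dividing \<open>c * u x + d * v x\<close> by \<open>s\<close>
    then gives a combination of \<open>u x / a\<close> and \<open>v x / b\<close> with weights of
    sum 1.\<close>
  define \<kappa> \<rho> where "\<kappa> = c * a / s" and "\<rho> = d * b / s"
  have s: "s > 0"
    using cd a(1) b(1) unfolding s_def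
    by (cases "c = 0") (auto intro!: add_pos_nonneg)
  have kr: "\<kappa> \<ge> 0" "\<rho> \<ge> 0" "\<kappa> + \<rho> = 1"
    using s cd a(1) b(1) by (auto simp: \<kappa>_def \<rho>_def s_def add_divide_distrib[symmetric])
  let ?R = "\<lambda>x. s powr p * \<sigma> * (\<kappa> * (u x powr p / a powr p) + \<rho> * (v x powr p / b powr p))"
  have pointwise: "\<sigma> * (c * u x + d * v x) powr p \<le> ?R x" if x: "x \<in> space M" for x
  proof -
    have comb: "c * u x + d * v x = s * (\<kappa> * (u x / a) + \<rho> * (v x / b))"
      using s a(1) b(1) by (simp add: \<kappa>_def \<rho>_def field_simps)
    have "\<sigma> * (\<kappa> * (u x / a) + \<rho> * (v x / b)) powr p
        \<le> \<kappa> * (\<sigma> * (u x / a) powr p) + \<rho> * (\<sigma> * (v x / b) powr p)"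
      using conv[unfolded convex_on_def, THEN conjunct2, rule_format, of "u x / a" "v x / b" \<kappa> \<rho>]
        kr u(1)[OF x] v(1)[OF x] a(1) b(1) by (simp del: times_divide_eq_right)
    \<comment> \<open>The sign \<sigma> stays inside both sides, so only the nonnegative factor
      \<open>s powr p\<close> is multiplied in; homogeneity of the power then removes the
      normalisation by \<open>s\<close>.\<close>
    then have "s powr p * (\<sigma> * (\<kappa> * (u x / a) + \<rho> * (v x / b)) powr p)
        \<le> s powr p * (\<kappa> * (\<sigma> * (u x / a) powr p) + \<rho> * (\<sigma> * (v x / b) powr p))"
      by (intro mult_left_mono) auto
    then show ?thesis
      unfolding comb powr_mult powr_divide by (simp only: algebra_simps)
  qed
  have "\<sigma> * (\<integral>x. (c * u x + d * v x) powr p \<partial>M) = (\<integral>x. \<sigma> * (c * u x + d * v x) powr p \<partial>M)"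
    by simp
  also have "\<dots> \<le> (\<integral>x. ?R x \<partial>M)"
    using u v uv pointwise by (intro integral_mono) auto
  also have "\<dots> = s powr p * \<sigma> *
      (\<kappa> * ((\<integral>x. u x powr p \<partial>M) / a powr p) + \<rho> * ((\<integral>x. v x powr p \<partial>M) / b powr p))"
    using u(2) v(2) by simp
  \<comment> \<open>By the choice of \<open>a\<close> and \<open>b\<close>, the p-th powers of
    \<open>u / a\<close> and \<open>v / b\<close> both integrate to 1.\<close>
  also have "\<dots> = s powr p * \<sigma> * (\<kappa> + \<rho>)"
    using a(1) b(1) by (simp flip: a(2) b(2))
  also have "\<dots> = \<sigma> * s powr p"
    by (simp add: kr)
  finally show ?thesis
    unfolding s_def .
qed

theorem proposition3:
  fixes \<alpha> :: real
    and M :: "'x measure"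
    and h :: "'x \<Rightarrow> real ^ 'd"
    and \<Omega> :: "(real ^ 'd) set"
  assumes alpha_pos: "\<alpha> > 0"
    and prob: "prob_space M"
    and h_measurable: "h \<in> borel_measurable M"
    and h_pos: "\<And>x i. x \<in> space M \<Longrightarrow> h x $ i > 0"
    and identifiable: "\<And>\<xi> \<xi>'. (AE x in M. \<xi> \<bullet> h x = \<xi>' \<bullet> h x) \<Longrightarrow> \<xi> = \<xi>'"
    and open_Omega: "open \<Omega>"
    and convex_Omega: "convex \<Omega>"
    and base_pos: "\<And>\<xi> x. \<xi> \<in> \<Omega> \<Longrightarrow> x \<in> space M \<Longrightarrow> 1 + \<alpha> * (\<xi> \<bullet> h x) > 0"
    and finite_integral: "\<And>\<xi>. \<xi> \<in> \<Omega> \<Longrightarrow> integrable M (unnormalised \<alpha> h \<xi>)"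
    and diff_under_integral: "differentiable_under_integral 2 M \<Omega> (unnormalised \<alpha> h)"
  shows "(\<alpha> < 1 \<longrightarrow> exponentially_convex_on \<alpha> \<Omega> (potential \<alpha> M h)) \<and>
         (\<alpha> > 1 \<longrightarrow> exponentially_concave_on \<alpha> \<Omega> (potential \<alpha> M h))"
proof -
  interpret prob_space M by (rule prob)
  define I where "I \<xi> = (\<integral>x. unnormalised \<alpha> h \<xi> x \<partial>M)" for \<xi>
  have I_pos: "I \<xi> > 0" if "\<xi> \<in> \<Omega>" for \<xi>
    unfolding I_def using base_pos[OF that]
    by (intro expectation_greater[OF finite_integral[OF that]] AE_I2)
       (auto simp: unnormalised_def less_imp_neq[symmetric])
  \<comment> \<open>Positivity of \<open>I \<xi>\<close> excludes the base 0, where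
    \<open>powr\<close> is 0 by convention rather than an exponential of \<open>ln\<close>.\<close>
  have exp_potential: "exp (\<alpha> * potential \<alpha> M h \<xi>) = I \<xi> powr \<alpha>" if "\<xi> \<in> \<Omega>" for \<xi>
    using I_pos[OF that] by (simp add: potential_def I_def powr_def)
  have mink: "\<sigma> * I (c *\<^sub>R \<xi> + d *\<^sub>R \<eta>) \<le> \<sigma> * (c * I \<xi> powr \<alpha> + d * I \<eta> powr \<alpha>) powr (1 / \<alpha>)"
    if conv: "convex_on {0<..} (\<lambda>x::real. \<sigma> * x powr (1 / \<alpha>))"
      and \<xi>: "\<xi> \<in> \<Omega>" and \<eta>: "\<eta> \<in> \<Omega>" and cd: "c \<ge> 0" "d \<ge> 0" "c + d = 1"
    for \<sigma> c d \<xi> \<eta>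
  proof -
    let ?u = "\<lambda>\<xi> x. 1 + \<alpha> * (\<xi> \<bullet> h x)"
    \<comment> \<open>The constant term 1 splits as \<open>c + d\<close>.\<close>
    have affine: "?u (c *\<^sub>R \<xi> + d *\<^sub>R \<eta>) x = c * ?u \<xi> x + d * ?u \<eta> x" for x
    proof -
      have "c * ?u \<xi> x + d * ?u \<eta> x = (c + d) + \<alpha> * ((c *\<^sub>R \<xi> + d *\<^sub>R \<eta>) \<bullet> h x)"
        by (simp add: inner_add_left algebra_simps)
      then show ?thesis
        using cd(3) by simp
    qed
    have \<zeta>: "c *\<^sub>R \<xi> + d *\<^sub>R \<eta> \<in> \<Omega>"
      using convexD[OF convex_Omega \<xi> \<eta> cd] .
    have int: "integrable M (\<lambda>x. ?u \<xi> x powr (1 / \<alpha>))" if "\<xi> \<in> \<Omega>" for \<xi>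
      using finite_integral[OF that] unfolding unnormalised_def .
    \<comment> \<open>This makes \<open>I \<xi> powr \<alpha>\<close> the normalising constant of
      \<open>?u \<xi>\<close> for the exponent \<open>1 / \<alpha>\<close>.\<close>
    have val: "(I \<xi> powr \<alpha>) powr (1 / \<alpha>) = (\<integral>x. ?u \<xi> x powr (1 / \<alpha>) \<partial>M)" if "\<xi> \<in> \<Omega>" for \<xi>
      using I_pos[OF that] alpha_pos by (simp add: powr_powr I_def unnormalised_def)
    have pos: "I \<xi> powr \<alpha> > 0" if "\<xi> \<in> \<Omega>" for \<xi>
      using I_pos[OF that] by simp
    have "\<sigma> * (\<integral>x. (c * ?u \<xi> x + d * ?u \<eta> x) powr (1 / \<alpha>) \<partial>M)
        \<le> \<sigma> * (c * I \<xi> powr \<alpha> + d * I \<eta> powr \<alpha>) powr (1 / \<alpha>)"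
      using int[OF \<zeta>]
      by (intro signed_Minkowski_integral[OF conv base_pos[OF \<xi>] int[OF \<xi>] base_pos[OF \<eta>] int[OF \<eta>]
            _ cd pos[OF \<xi>] val[OF \<xi>] pos[OF \<eta>] val[OF \<eta>]]) (simp_all only: affine)
    then show ?thesis
      by (simp only: I_def unnormalised_def affine)
  qed
  \<comment> \<open>The root is undone because nonnegative weights keep its base
    nonnegative.\<close>
  have root: "((c * I \<xi> powr \<alpha> + d * I \<eta> powr \<alpha>) powr (1 / \<alpha>)) powr \<alpha>
      = c * I \<xi> powr \<alpha> + d * I \<eta> powr \<alpha>" if "c \<ge> 0" "d \<ge> 0" for c d \<xi> \<eta>
    using that alpha_pos by (simp add: powr_powr)
  have "exponentially_convex_on \<alpha> \<Omega> (potential \<alpha> M h)" if "\<alpha> < 1"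
    unfolding exponentially_convex_on_def convex_on_def
  proof (intro conjI convex_Omega ballI allI impI)
    fix \<xi> \<eta> and c d :: real
    assume *: "\<xi> \<in> \<Omega>" "\<eta> \<in> \<Omega>" "c \<ge> 0" "d \<ge> 0" "c + d = 1"
    have "c *\<^sub>R \<xi> + d *\<^sub>R \<eta> \<in> \<Omega>"
      using convexD[OF convex_Omega *] .
    \<comment> \<open>Direct inequality: here \<open>1 / \<alpha>\<close> exceeds 1, so the power is
      convex. Raising both sides to the power \<alpha> then preserves the order.\<close>
    moreover have "I (c *\<^sub>R \<xi> + d *\<^sub>R \<eta>) \<le> (c * I \<xi> powr \<alpha> + d * I \<eta> powr \<alpha>) powr (1 / \<alpha>)"
      using mink[of 1, OF _ *] powr_convex[of "1 / \<alpha>"] alpha_pos that by simp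
    ultimately have "I (c *\<^sub>R \<xi> + d *\<^sub>R \<eta>) powr \<alpha> \<le> c * I \<xi> powr \<alpha> + d * I \<eta> powr \<alpha>"
      using powr_mono2[of \<alpha>] alpha_pos I_pos root[of c d \<xi> \<eta>] * by (metis less_imp_le)
    then show "exp (\<alpha> * potential \<alpha> M h (c *\<^sub>R \<xi> + d *\<^sub>R \<eta>))
        \<le> c * exp (\<alpha> * potential \<alpha> M h \<xi>) + d * exp (\<alpha> * potential \<alpha> M h \<eta>)"
      using * \<open>c *\<^sub>R \<xi> + d *\<^sub>R \<eta> \<in> \<Omega>\<close> by (simp add: exp_potential)
  qed
  moreover have "exponentially_concave_on \<alpha> \<Omega> (potential \<alpha> M h)" if "\<alpha> > 1"
    unfolding exponentially_concave_on_def concave_on_iff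
  proof (intro conjI convex_Omega ballI allI impI)
    fix \<xi> \<eta> and c d :: real
    assume *: "\<xi> \<in> \<Omega>" "\<eta> \<in> \<Omega>" "c \<ge> 0" "d \<ge> 0" "c + d = 1"
    have "c *\<^sub>R \<xi> + d *\<^sub>R \<eta> \<in> \<Omega>"
      using convexD[OF convex_Omega *] .
    \<comment> \<open>Reverse inequality: \<open>1 / \<alpha>\<close> lies below 1, so minus the
      power is convex, and cancelling \<sigma> = -1 flips the estimate.\<close>
    moreover have "(c * I \<xi> powr \<alpha> + d * I \<eta> powr \<alpha>) powr (1 / \<alpha>) \<le> I (c *\<^sub>R \<xi> + d *\<^sub>R \<eta>)"
      using mink[of "-1", OF _ *] powr_concave[of "1 / \<alpha>"] that by (simp add: concave_on_def)
    then have "c * I \<xi> powr \<alpha> + d * I \<eta> powr \<alpha> \<le> I (c *\<^sub>R \<xi> + d *\<^sub>R \<eta>) powr \<alpha>"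
      using powr_mono2[of \<alpha>] alpha_pos root[of c d \<xi> \<eta>] * by (metis less_imp_le powr_ge_zero)
    ultimately show "c * exp (\<alpha> * potential \<alpha> M h \<xi>) + d * exp (\<alpha> * potential \<alpha> M h \<eta>)
        \<le> exp (\<alpha> * potential \<alpha> M h (c *\<^sub>R \<xi> + d *\<^sub>R \<eta>))"
      using * by (simp add: exp_potential)
  qed
  ultimately show ?thesis
    by blast
qed

end
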